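(* Let $\theta\in\mathbb R$, $\eta=e^{i\theta}$ and $q=\sin\theta$, and assume $\frac1{\sqrt2}<q\le1$. Let $c_0=d_0=w_0=0$, let $c_1,c_2$ be the two roots of $$-i\sqrt2\,\eta c^2+\eta c-1=0,$$ and for $j=1,2$ set $$d_j=\eta c_j^2=\frac{c_j}{1-i\sqrt2c_j},\qquad w_j=\frac{c_j+d_j}{\sqrt2}.$$ For $a\in\mathbb D$ define $$B_a(w)=w\,\frac{w-a}{1-\bar aw}.$$ Then the matrix $$R_{jk}=\frac{1-\bar d_jd_k}{1-\bar c_jc_k},\qquad 0\le j,k\le2,$$ is positive semidefinite of rank two, and for every $a\in\mathbb D$ the matrix $$T_{jk}=\frac{2-\overline{B_a(w_j)}B_a(w_k)}{1-\bar c_jc_k},\qquad 0\le j,k\le2,$$ is positive definite. The same conclusion holds for a unimodular multiple of $B_a$.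
   Context: $\mathbb D=\{z\in\mathbb C:|z|<1\}$ is the open unit disk. *)

theory Defs
  imports "HOL-Analysis.Analysis"
begin

definition quadratic_form :: "complex ^ 'n ^ 'n \<Rightarrow> complex ^ 'n \<Rightarrow> complex" where
  "quadratic_form A v = (\<Sum>j\<in>UNIV. \<Sum>k\<in>UNIV. cnj (v $ j) * A $ j $ k * v $ k)"

definition hermitian_matrix :: "complex ^ 'n ^ 'n \<Rightarrow> bool" where
  "hermitian_matrix A \<longleftrightarrow> (\<forall>j k. A $ k $ j = cnj (A $ j $ k))"

text \<open>For a Hermitian matrix the quadratic form is real, so taking \<open>Re\<close> below loses nothing.\<close>

definition positive_semidefinite :: "complex ^ 'n ^ 'n \<Rightarrow> bool" where
  "positive_semidefinite A \<longleftrightarrow>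
     hermitian_matrix A \<and> (\<forall>v. 0 \<le> Re (quadratic_form A v))"

definition positive_definite :: "complex ^ 'n ^ 'n \<Rightarrow> bool" where
  "positive_definite A \<longleftrightarrow>
     hermitian_matrix A \<and> (\<forall>v. v \<noteq> 0 \<longrightarrow> 0 < Re (quadratic_form A v))"

definition blaschke :: "complex \<Rightarrow> complex \<Rightarrow> complex" where
  "blaschke a w = w * ((w - a) / (1 - cnj a * w))"

text \<open>The indices 0, 1, 2 are the three elements of the numeral type \<open>3\<close>
  (whose arithmetic is modulo 3, so that \<open>3 = 0\<close>).\<close>

definition R_matrix :: "(3 \<Rightarrow> complex) \<Rightarrow> (3 \<Rightarrow> complex) \<Rightarrow> complex ^ 3 ^ 3" where
  "R_matrix c d = (\<chi> j k. (1 - cnj (d j) * d k) / (1 - cnj (c j) * c k))"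

definition T_matrix ::
  "(complex \<Rightarrow> complex) \<Rightarrow> (3 \<Rightarrow> complex) \<Rightarrow> (3 \<Rightarrow> complex) \<Rightarrow> complex ^ 3 ^ 3" where
  "T_matrix B c w = (\<chi> j k. (2 - cnj (B (w j)) * B (w k)) / (1 - cnj (c j) * c k))"

end

theory Submission
  imports Defs
begin

text \<open>Since \<open>d j = \<eta> * (c j)\<^sup>2\<close> at every node, including the node \<open>0\<close>, the fraction defining
  \<open>R\<close> cancels to \<open>1 + cnj (c j) * c k\<close>. This is the Gram matrix of the two functions \<open>1\<close> and
  \<open>c\<close> on the nodes, which are linearly independent because \<open>c 0 = 0 \<noteq> c 1\<close>.

  For \<open>T\<close>, write \<open>w j = c j * v j\<close> with \<open>v j = (1 + \<eta> * c j) / sqrt 2\<close>. Then the value of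
  \<open>B\<close> at \<open>w j\<close> is \<open>c j * f j\<close>, where \<open>f j\<close> is \<open>v j\<close> times the value of a disc automorphism, and
  subtracting the constant \<open>2\<close> from every entry of \<open>T\<close> (a Schur complement at the node \<open>0\<close>) leaves,
  up to a diagonal congruence by \<open>c 1\<close> and \<open>c 2\<close>, the two-by-two Pick matrix \<open>(2 - cnj (f j) * f k) / (1 - cnj (c j) * c k)\<close>
  with \<open>j, k \<in> {1, 2}\<close>. That matrix is positive definite with so much room that the parameter \<open>a\<close> does not matter:
  the bound \<open>cmod (f j) \<le> cmod (v j)\<close> and the triangle inequality suffice.

  What makes this explicit is that the resulting estimate involves only \<open>p = x1 + x2\<close>, where
  \<open>x1\<close>, \<open>x2\<close> are the squared moduli of the two roots. By the formulas for the sum and the product of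
  the roots, \<open>x1 * x2 = 1/2\<close> and \<open>(cmod (1 - cnj (c 1) * c 2))\<^sup>2 = 1 + p\<close>; by the quadratic equation
  and the parallelogram law, \<open>(cmod (v j))\<^sup>2 = 1 + x - x\<^sup>2\<close> with \<open>x = (cmod (c j))\<^sup>2\<close>.
  The discriminant of the equation turns the condition \<open>1 / sqrt 2 < sin \<theta>\<close> into \<open>p < 3/2\<close>,
  that is, \<open>(1 - x1) * (1 - x2) > 0\<close>, which together with \<open>x1 * x2 < 1\<close> puts both roots in the open disc. Since \<open>p\<^sup>2 \<ge> 2\<close> as well,
  \<open>p\<close> is confined to a short interval, on which the determinant of the Pick matrix is estimated
  (\<open>root_moduli\<close>, \<open>pick_determinant_estimate\<close>, \<open>positive_definite_T_matrix\<close>).\<close>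

section \<open>Hermitian forms and the unit disc\<close>

lemma binary_hermitian_form_pos:
  fixes a d :: real and b y1 y2 :: complex
  assumes "0 < a" and det: "(cmod b)\<^sup>2 < a * d" and nz: "y1 \<noteq> 0 \<or> y2 \<noteq> 0"
  shows "0 < a * (cmod y1)\<^sup>2 + d * (cmod y2)\<^sup>2 + 2 * Re (cnj y1 * b * y2)"
proof -
  \<comment> \<open>Completing the square in \<open>y1\<close>; the leftover coefficient is the determinant.\<close>
  have "a * (a * (cmod y1)\<^sup>2 + d * (cmod y2)\<^sup>2 + 2 * Re (cnj y1 * b * y2))
      = (cmod (of_real a * y1 + b * y2))\<^sup>2 + (a * d - (cmod b)\<^sup>2) * (cmod y2)\<^sup>2"
    unfolding cmod_power2 by (simp add: power2_eq_square algebra_simps)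
  moreover have "0 < \<dots>"
  proof (cases "y2 = 0")
    case True
    then show ?thesis using nz \<open>0 < a\<close> by simp
  next
    case False
    then show ?thesis using det by (intro add_nonneg_pos mult_pos_pos) auto
  qed
  ultimately show ?thesis
    using \<open>0 < a\<close> by (metis zero_less_mult_pos)
qed

lemma cmod_one_minus_cnj_mult:
  fixes z w :: complex
  shows "(cmod (1 - cnj z * w))\<^sup>2
       = (1 - (cmod z)\<^sup>2) * (1 - (cmod w)\<^sup>2) + (cmod (z - w))\<^sup>2"
  unfolding cmod_power2 by (simp add: power2_eq_square algebra_simps)

lemma one_minus_cnj_mult_nonzero:
  fixes z w :: complex
  assumes "cmod z < 1" "cmod w \<le> 1"
  shows "1 - cnj z * w \<noteq> 0"
proof
  assume "1 - cnj z * w = 0"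
  then have "cmod z * cmod w = 1"
    by (metis complex_mod_cnj eq_iff_diff_eq_0 norm_mult norm_one)
  moreover have "cmod z * cmod w \<le> cmod z"
    using assms by (simp add: mult_left_le)
  ultimately show False using assms by simp
qed

lemma cmod_blaschke_factor_le_1:
  fixes a w :: complex
  assumes "cmod a < 1" "cmod w < 1"
  shows "cmod ((w - a) / (1 - cnj a * w)) \<le> 1"
proof -
  have "0 \<le> (1 - (cmod a)\<^sup>2) * (1 - (cmod w)\<^sup>2)"
    using assms by (intro mult_nonneg_nonneg) (simp_all add: power_le_one)
  then have "(cmod (w - a))\<^sup>2 \<le> (cmod (1 - cnj a * w))\<^sup>2"
    by (simp add: cmod_one_minus_cnj_mult norm_minus_commute)
  then have "cmod (w - a) \<le> cmod (1 - cnj a * w)"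
    by (rule power2_le_imp_le) simp
  then show ?thesis
    using one_minus_cnj_mult_nonzero[of a w] assms by (simp add: norm_divide)
qed

section \<open>The matrices at the nodes\<close>

text \<open>This is positivity of the determinant of the two-by-two Pick matrix, with the denominators cleared.
  For \<open>p = x1 + x2\<close> the diagonal factors multiply to at least \<open>p\<^sup>2 - 3/2 * p + 3/4 \<ge> 1/2\<close>, because
  \<open>p\<^sup>2 \<ge> 2\<close> and \<open>p < 3/2\<close>. The off-diagonal term is bounded by the triangle inequality, and its factor
  \<open>(1 - x1) * (1 - x2) = 3/2 - p\<close> is below \<open>0.09\<close> because \<open>p \<ge> sqrt 2 > 1.41\<close>.\<close>

lemma pick_determinant_estimate:
  fixes x1 x2 :: real and f1 f2 :: complex
  assumes x: "x1 * x2 = 1/2" "0 < x1" "x1 < 1" "x2 < 1" "x1 + x2 < 3/2"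
    and f1: "(cmod f1)\<^sup>2 \<le> 1 + x1 - x1\<^sup>2"
    and f2: "(cmod f2)\<^sup>2 \<le> 1 + x2 - x2\<^sup>2"
  shows "(cmod (2 - cnj f1 * f2))\<^sup>2 * ((1 - x1) * (1 - x2))
       < (2 - (cmod f1)\<^sup>2) * (2 - (cmod f2)\<^sup>2) * (1 + (x1 + x2))"
proof -
  define p where "p = x1 + x2"
  have x2: "0 < x2" using x zero_less_mult_pos[of x1 x2] by simp
  have "0 \<le> (x1 - x2)\<^sup>2" by simp
  then have "2 \<le> p\<^sup>2"
    using x(1) unfolding p_def by (simp add: power2_eq_square algebra_simps)
  have p141: "141/100 < p"
  proof (rule ccontr)
    assume "\<not> 141/100 < p"
    then have "p\<^sup>2 \<le> (141/100)\<^sup>2" using x2 x by (intro power_mono) (auto simp: p_def)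
    with \<open>2 \<le> p\<^sup>2\<close> show False by (simp add: power2_eq_square)
  qed
  have p32: "p < 3/2" using x by (simp add: p_def)
  have "(1 + x1 - x1\<^sup>2) * (1 + x2 - x2\<^sup>2)
      = 1 + p - p\<^sup>2 + 3 * (x1 * x2) - (x1 * x2) * p + (x1 * x2)\<^sup>2"
    unfolding p_def by (simp add: power2_eq_square algebra_simps)
  then have up: "(1 + x1 - x1\<^sup>2) * (1 + x2 - x2\<^sup>2) = 11/4 + p/2 - p\<^sup>2"
    unfolding x(1) by (simp add: power2_eq_square)
  have "(1 - x1 + x1\<^sup>2) * (1 - x2 + x2\<^sup>2)
      = 1 - p + p\<^sup>2 - x1 * x2 - (x1 * x2) * p + (x1 * x2)\<^sup>2"
    unfolding p_def by (simp add: power2_eq_square algebra_simps)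
  then have lo: "(1 - x1 + x1\<^sup>2) * (1 - x2 + x2\<^sup>2) = p\<^sup>2 - 3/2 * p + 3/4"
    unfolding x(1) by (simp add: power2_eq_square)
  have "(1 - x1) * (1 - x2) = 1 - p + x1 * x2"
    unfolding p_def by (simp add: algebra_simps)
  then have prod: "(1 - x1) * (1 - x2) = 3/2 - p"
    unfolding x(1) by simp
  have "(cmod f1 * cmod f2)\<^sup>2 \<le> (1 + x1 - x1\<^sup>2) * (1 + x2 - x2\<^sup>2)"
    unfolding power_mult_distrib using f1 f2 order_trans[OF zero_le_power2 f1]
    by (intro mult_mono) auto
  also have "\<dots> \<le> (5/4)\<^sup>2"
    using \<open>2 \<le> p\<^sup>2\<close> p32 unfolding up by (simp add: power2_eq_square)
  finally have "cmod f1 * cmod f2 \<le> 5/4"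
    by (rule power2_le_imp_le) simp
  moreover have "cmod (2 - cnj f1 * f2) \<le> 2 + cmod f1 * cmod f2"
    using norm_triangle_ineq4[of 2 "cnj f1 * f2"] by (simp add: norm_mult)
  ultimately have "(cmod (2 - cnj f1 * f2))\<^sup>2 \<le> (13/4)\<^sup>2"
    by (intro power_mono) auto
  then have "(cmod (2 - cnj f1 * f2))\<^sup>2 * (3/2 - p) \<le> (13/4)\<^sup>2 * (9/100)"
    using p141 p32 by (intro mult_mono) auto
  also have "\<dots> < 1/2 * (241/100 :: real)" by (simp add: power2_eq_square)
  also have "\<dots> \<le> (p\<^sup>2 - 3/2 * p + 3/4) * (1 + p)"
  proof (rule mult_mono)
    show "1/2 \<le> p\<^sup>2 - 3/2 * p + 3/4" using \<open>2 \<le> p\<^sup>2\<close> p32 by simp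
    then show "0 \<le> p\<^sup>2 - 3/2 * p + 3/4" by linarith
  qed (use p141 in auto)
  also have "\<dots> \<le> (2 - (cmod f1)\<^sup>2) * (2 - (cmod f2)\<^sup>2) * (1 + p)"
  proof (rule mult_right_mono)
    have "0 \<le> 1 - x1 + x1\<^sup>2" "0 \<le> 1 - x2 + x2\<^sup>2" using x by auto
    then show "p\<^sup>2 - 3/2 * p + 3/4 \<le> (2 - (cmod f1)\<^sup>2) * (2 - (cmod f2)\<^sup>2)"
      unfolding lo[symmetric] using f1 f2 by (intro mult_mono) auto
  qed (use p141 in auto)
  finally show ?thesis unfolding prod by (simp add: p_def)
qed

text \<open>The library enumerates the type \<open>3\<close> as \<open>1, 2, 3\<close>; here the distinguished node carries the index
  \<open>0\<close>, which is the same element as \<open>3\<close>.\<close>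

lemma UNIV_3_zero: "(UNIV :: 3 set) = {0, 1, 2}"
proof -
  have "(3::3) = 0" by simp
  then show ?thesis using UNIV_3 by auto
qed

lemma sum_UNIV_3: "sum g (UNIV :: 3 set) = g 0 + g 1 + g 2"
  unfolding UNIV_3_zero by (simp add: add.assoc)

lemma forall_3_zero: "(\<forall>j::3. P j) \<longleftrightarrow> P 0 \<and> P 1 \<and> P 2"
proof -
  have "(\<forall>j::3. P j) \<longleftrightarrow> (\<forall>j\<in>{0, 1, 2}. P j)"
    unfolding UNIV_3_zero[symmetric] by simp
  then show ?thesis by simp
qed

text \<open>As \<open>c\<close> and \<open>B \<circ> w\<close> vanish at the node \<open>0\<close>, the first row and column of \<open>T\<close> are constantly \<open>2\<close>.
  Removing the rank-one form \<open>2 * (cmod (y 0 + y 1 + y 2))\<^sup>2\<close> leaves the Pick form of \<open>f\<close> at the other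
  two nodes, evaluated at the vector with components \<open>c j * y j\<close>. Hence the hypotheses only concern the
  first diagonal entry and the determinant of that two-by-two form.\<close>

lemma positive_definite_T_matrix:
  fixes c w f :: "3 \<Rightarrow> complex" and B :: "complex \<Rightarrow> complex"
  assumes zero: "c 0 = 0" "B (w 0) = 0"
    and nz: "c 1 \<noteq> 0" "c 2 \<noteq> 0"
    and c1: "cmod (c 1) < 1" and c2: "cmod (c 2) < 1"
    and B: "B (w 1) = c 1 * f 1" "B (w 2) = c 2 * f 2"
    and diag: "(cmod (f 1))\<^sup>2 < 2"
    and det: "(cmod (2 - cnj (f 1) * f 2))\<^sup>2 * ((1 - (cmod (c 1))\<^sup>2) * (1 - (cmod (c 2))\<^sup>2))
       < (2 - (cmod (f 1))\<^sup>2) * (2 - (cmod (f 2))\<^sup>2) * (cmod (1 - cnj (c 1) * c 2))\<^sup>2"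
  shows "positive_definite (T_matrix B c w)"
proof -
  define Q where "Q j k = (2 - cnj (f j) * f k) / (1 - cnj (c j) * c k)" for j k
  define r where "r j = (2 - (cmod (f j))\<^sup>2) / (1 - (cmod (c j))\<^sup>2)" for j
  have Qr: "Q j j = of_real (r j)" for j
    unfolding Q_def r_def by (simp add: mult.commute complex_norm_square[symmetric])
  have Q21: "Q 2 1 = cnj (Q 1 2)"
    unfolding Q_def by (simp add: mult.commute)
  have den: "1 - cnj (c j) * c k \<noteq> 0" if "j \<in> {1,2}" "k \<in> {1,2}" for j k
  proof -
    have "cmod (c j) < 1" "cmod (c k) < 1" using that c1 c2 by auto
    then show ?thesis by (simp only: one_minus_cnj_mult_nonzero less_imp_le not_False_eq_True)
  qed
  have T: "T_matrix B c w $ j $ k = 2 + cnj (c j) * c k * Q j k"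
    if "j \<in> {1,2}" "k \<in> {1,2}" for j k
    using den[OF that] B that unfolding T_matrix_def Q_def
    by (auto simp: field_simps)
  have T0: "T_matrix B c w $ 0 $ k = 2" "T_matrix B c w $ k $ 0 = 2" for k
    by (simp_all add: T_matrix_def zero)
  have s: "0 < 1 - (cmod (c 1))\<^sup>2" "0 < 1 - (cmod (c 2))\<^sup>2"
    using c1 c2 by (simp_all add: power_less_one_iff abs_square_less_1)
  have r1: "0 < r 1" unfolding r_def using diag s by simp
  have detQ: "(cmod (Q 1 2))\<^sup>2 < r 1 * r 2"
  proof -
    have "0 < (cmod (1 - cnj (c 1) * c 2))\<^sup>2" using den[of 1 2] by simp
    then show ?thesis
      using det s unfolding Q_def r_def norm_divide power_divide
      by (simp add: divide_simps mult_ac)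
  qed
  have herm: "hermitian_matrix (T_matrix B c w)"
    unfolding hermitian_matrix_def T_matrix_def by (simp add: mult.commute)
  have "0 < Re (quadratic_form (T_matrix B c w) y)" if "y \<noteq> 0" for y
  proof -
    define u where "u = y $ 0 + y $ 1 + y $ 2"
    define z1 z2 where "z1 = c 1 * y $ 1" and "z2 = c 2 * y $ 2"
    have "quadratic_form (T_matrix B c w) y
        = 2 * (cnj u * u)
          + (cnj z1 * Q 1 1 * z1 + cnj z2 * Q 2 2 * z2 + cnj z1 * Q 1 2 * z2 + cnj z2 * Q 2 1 * z1)"
      unfolding quadratic_form_def sum_UNIV_3 u_def z1_def z2_def
      by (simp add: T T0 algebra_simps)
    then have form: "Re (quadratic_form (T_matrix B c w) y)
        = 2 * (cmod u)\<^sup>2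
          + (r 1 * (cmod z1)\<^sup>2 + r 2 * (cmod z2)\<^sup>2 + 2 * Re (cnj z1 * Q 1 2 * z2))"
      unfolding Qr Q21 cmod_power2 by (simp add: power2_eq_square algebra_simps)
    show ?thesis
    proof (cases "z1 = 0 \<and> z2 = 0")
      case True
      then have "y $ 1 = 0" "y $ 2 = 0" using nz by (auto simp: z1_def z2_def)
      moreover from this have "y $ 0 \<noteq> 0"
        using that by (auto simp: vec_eq_iff forall_3_zero)
      ultimately have "u \<noteq> 0" by (simp add: u_def)
      then show ?thesis unfolding form using True by simp
    next
      case False
      then have "0 < r 1 * (cmod z1)\<^sup>2 + r 2 * (cmod z2)\<^sup>2 + 2 * Re (cnj z1 * Q 1 2 * z2)"
        by (intro binary_hermitian_form_pos[OF r1 detQ]) blast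
      then show ?thesis
        unfolding form by (rule add_nonneg_pos[rotated]) simp
    qed
  qed
  with herm show ?thesis by (simp add: positive_definite_def)
qed

text \<open>Row \<open>j\<close> is \<open>e + cnj (c j) *s g\<close> with \<open>e\<close> the all-ones vector and \<open>g = c\<close>. Rows \<open>0\<close> and \<open>1\<close> recover
  \<open>e\<close> and \<open>g\<close>, and evaluation at the index \<open>0\<close> separates \<open>e\<close> from the line through \<open>g\<close>.\<close>

lemma rank_one_plus_gram:
  fixes c :: "3 \<Rightarrow> complex"
  assumes zero: "c 0 = 0" and nz: "c 1 \<noteq> 0"
  shows "rank (\<chi> j k. 1 + cnj (c j) * c k :: complex ^ 3 ^ 3) = 2"
proof -
  define A where "A = (\<chi> j k. 1 + cnj (c j) * c k :: complex ^ 3 ^ 3)"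
  define e g :: "complex ^ 3" where "e = (\<chi> k. 1)" and "g = (\<chi> k. c k)"
  have row: "row j A = e + cnj (c j) *s g" for j
    by (simp add: row_def A_def e_def g_def vec_eq_iff)
  have ne: "e \<noteq> g" using zero by (auto simp: e_def g_def vec_eq_iff intro!: exI[of _ 0])
  have ind: "vec.independent {e, g}"
  proof -
    have "g \<noteq> 0" using nz by (auto simp: g_def vec_eq_iff)
    moreover have "e \<notin> vec.span {g}"
    proof
      assume "e \<in> vec.span {g}"
      then obtain k where "e = k *s g" by (auto simp: vec.span_singleton)
      then have "e $ 0 = k * g $ 0" by simp
      then show False using zero by (simp add: e_def g_def)
    qed
    ultimately show ?thesis using ne by (simp add: vec.independent_insert)
  qed
  have row_in: "e + cnj (c j) *s g \<in> vec.span (rows A)" for j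
    unfolding row[symmetric] by (rule vec.span_base) (auto simp: rows_def)
  have e_in: "e \<in> vec.span (rows A)" using row_in[of 0] zero by simp
  from vec.span_diff[OF row_in[of 1] e_in] have "cnj (c 1) *s g \<in> vec.span (rows A)" by simp
  from vec.span_scale[OF this, of "inverse (cnj (c 1))"] have g_in: "g \<in> vec.span (rows A)"
    using nz by simp
  have "vec.span (rows A) = vec.span {e, g}"
  proof (rule subset_antisym)
    show "vec.span (rows A) \<subseteq> vec.span {e, g}"
    proof (rule vec.span_minimal)
      have "e + cnj (c j) *s g \<in> vec.span {e, g}" for j
        by (intro vec.span_add vec.span_scale vec.span_base) simp_all
      then show "rows A \<subseteq> vec.span {e, g}" by (auto simp: rows_def row)
    qed simp
    show "vec.span {e, g} \<subseteq> vec.span (rows A)"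
      using e_in g_in by (intro vec.span_minimal) auto
  qed
  then have "vec.dim (rows A) = card {e, g}"
    using ind vec.dim_eq_card[of "{e, g}" "rows A"] by simp
  then show ?thesis using ne by (simp add: row_rank_def_gen A_def)
qed

lemma R_matrix_eq:
  fixes c d :: "3 \<Rightarrow> complex"
  assumes "cmod \<eta> = 1" and "\<And>j. d j = \<eta> * (c j)\<^sup>2"
    and "\<And>j k. 1 - cnj (c j) * c k \<noteq> 0"
  shows "R_matrix c d = (\<chi> j k. 1 + cnj (c j) * c k)"
proof -
  have "cnj \<eta> * \<eta> = 1"
    using assms(1) complex_norm_square[of \<eta>] by (simp add: mult.commute)
  have "cnj (d j) * d k = (cnj \<eta> * \<eta>) * (cnj (c j) * c k)\<^sup>2" for j k
    unfolding assms(2) by (simp add: power_mult_distrib mult_ac)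
  then have "1 - cnj (d j) * d k = (1 + cnj (c j) * c k) * (1 - cnj (c j) * c k)" for j k
    unfolding \<open>cnj \<eta> * \<eta> = 1\<close> by (simp add: algebra_simps power2_eq_square)
  then show ?thesis
    using assms(3) by (simp add: R_matrix_def vec_eq_iff)
qed

lemma positive_semidefinite_one_plus_gram:
  fixes c :: "3 \<Rightarrow> complex"
  shows "positive_semidefinite (\<chi> j k. 1 + cnj (c j) * c k)"
  unfolding positive_semidefinite_def
proof (intro conjI allI)
  fix y :: "complex ^ 3"
  define u t where "u = (\<Sum>j\<in>UNIV. y $ j)" and "t = (\<Sum>j\<in>UNIV. c j * y $ j)"
  have "quadratic_form (\<chi> j k. 1 + cnj (c j) * c k) y = cnj u * u + cnj t * t"
    by (simp add: quadratic_form_def u_def t_def sum_UNIV_3 algebra_simps)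
  then show "0 \<le> Re (quadratic_form (\<chi> j k. 1 + cnj (c j) * c k) y)"
    by simp
qed (simp add: hermitian_matrix_def mult.commute)

section \<open>The two roots\<close>

text \<open>If \<open>c1\<close> is a root, then so is \<open>r = - \<i> / sqrt 2 - c1\<close>, so \<open>r\<close> is \<open>c2\<close> unless
  \<open>c1\<close> is a double root. A double root would force \<open>\<eta> = 4 * \<i> * sqrt 2\<close>, which is not unimodular.\<close>

lemma roots_sum_and_product:
  fixes \<eta> c1 c2 :: complex
  assumes "cmod \<eta> = 1"
    and roots: "{z. - \<i> * complex_of_real (sqrt 2) * \<eta> * z\<^sup>2 + \<eta> * z - 1 = 0} = {c1, c2}"
  shows "c1 + c2 = - \<i> / complex_of_real (sqrt 2)"
    and "\<i> * complex_of_real (sqrt 2) * \<eta> * (c1 * c2) = 1"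
proof -
  define s where "s = complex_of_real (sqrt 2)"
  have s2: "s * s = 2" unfolding s_def by (simp flip: of_real_mult)
  then have s0: "s \<noteq> 0" by auto
  have root: "- \<i> * s * \<eta> * z\<^sup>2 + \<eta> * z - 1 = 0 \<longleftrightarrow> z \<in> {c1, c2}" for z
    using roots unfolding s_def by blast
  define r where "r = - \<i> / s - c1"
  have e1: "- \<i> * s * \<eta> * c1\<^sup>2 + \<eta> * c1 - 1 = 0" using root[of c1] by simp
  have ir: "\<i> * s * r = 1 - \<i> * s * c1"
    using s0 by (simp add: r_def field_simps)
  have prod: "\<i> * s * \<eta> * (c1 * r) = 1"
  proof -
    have "\<i> * s * \<eta> * (c1 * r) = \<eta> * c1 * (\<i> * s * r)" by (simp add: mult_ac)
    also have "\<dots> = (- \<i> * s * \<eta> * c1\<^sup>2 + \<eta> * c1 - 1) + 1"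
      unfolding ir by (simp add: right_diff_distrib power2_eq_square mult_ac)
    finally show ?thesis unfolding e1 by simp
  qed
  have "- \<i> * s * \<eta> * r\<^sup>2 + \<eta> * r - 1 = 0"
  proof -
    have "- \<i> * s * \<eta> * r\<^sup>2 + \<eta> * r - 1 = \<eta> * r * (1 - \<i> * s * r) - 1"
      by (simp add: right_diff_distrib power2_eq_square mult_ac)
    also have "\<dots> = \<i> * s * \<eta> * (c1 * r) - 1"
      unfolding ir by (simp add: mult_ac)
    finally show ?thesis unfolding prod by simp
  qed
  then have "r \<in> {c1, c2}" using root by blast
  moreover have "r \<noteq> c1"
  proof
    assume "r = c1"
    with ir have two: "2 * (\<i> * s * r) = 1" by (simp add: algebra_simps)
    have "\<eta> * r = (2 * (\<i> * s * r)) * (\<eta> * r)" unfolding two by simp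
    also have "\<dots> = 2 * (\<i> * s * \<eta> * (c1 * r))" using \<open>r = c1\<close> by (simp add: mult_ac)
    finally have "\<eta> * r = 2" unfolding prod by simp
    have "\<eta> = \<eta> * (2 * (\<i> * s * r))" unfolding two by simp
    also have "\<dots> = 2 * (\<i> * s) * (\<eta> * r)" by (simp add: mult_ac)
    finally have "\<eta> = 4 * \<i> * s" unfolding \<open>\<eta> * r = 2\<close> by simp
    then have "cmod \<eta> = 4 * sqrt 2" by (simp add: norm_mult s_def)
    moreover have "1 \<le> sqrt 2" by simp
    ultimately show False using assms(1) by linarith
  qed
  ultimately have "r = c2" by auto
  then show "c1 + c2 = - \<i> / complex_of_real (sqrt 2)"
    and "\<i> * complex_of_real (sqrt 2) * \<eta> * (c1 * c2) = 1"
    using prod by (auto simp: r_def s_def)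
qed

text \<open>The parallelogram law expresses \<open>D = (cmod (c1 - c2))\<^sup>2\<close> through the squared moduli, while \<open>D\<^sup>2\<close>
  is the squared modulus of a discriminant and equals \<open>33/4 - 2 * sqrt 2 * sin \<theta>\<close>. So the lower bound on
  \<open>sin \<theta>\<close> amounts to \<open>D < 5/2\<close>, which is the bound \<open>3/2\<close> on the sum of the squared moduli; the product
  \<open>1/2\<close> then excludes that both roots lie outside the open disc.\<close>

lemma root_moduli:
  fixes \<theta> :: real and \<eta> c1 c2 :: complex
  assumes eta: "\<eta> = exp (\<i> * complex_of_real \<theta>)" and q: "1 / sqrt 2 < sin \<theta>"
    and roots: "{z. - \<i> * complex_of_real (sqrt 2) * \<eta> * z\<^sup>2 + \<eta> * z - 1 = 0} = {c1, c2}"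
  shows "(cmod c1)\<^sup>2 * (cmod c2)\<^sup>2 = 1/2"
    and "(cmod c1)\<^sup>2 + (cmod c2)\<^sup>2 < 3/2"
    and "cmod c1 < 1" and "cmod c2 < 1"
    and "(cmod (1 - cnj c1 * c2))\<^sup>2 = 1 + ((cmod c1)\<^sup>2 + (cmod c2)\<^sup>2)"
proof -
  define x1 x2 where "x1 = (cmod c1)\<^sup>2" and "x2 = (cmod c2)\<^sup>2"
  define D where "D = (cmod (c1 - c2))\<^sup>2"
  have e1: "cmod \<eta> = 1" by (simp add: eta)
  note sum = roots_sum_and_product(1)[OF e1 roots]
    and prod = roots_sum_and_product(2)[OF e1 roots]
  have "sqrt 2 * (cmod c1 * cmod c2) = 1"
    using arg_cong[OF prod, of cmod] e1 by (simp add: norm_mult)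
  then have "(sqrt 2 * (cmod c1 * cmod c2))\<^sup>2 = 1" by simp
  then have xx: "x1 * x2 = 1/2"
    by (simp add: x1_def x2_def power_mult_distrib)
  have "(cmod (c1 + c2))\<^sup>2 = 1/2"
    unfolding sum by (simp add: norm_divide power_divide)
  moreover have "(cmod (c1 + c2))\<^sup>2 + D = 2 * (x1 + x2)"
    unfolding D_def x1_def x2_def cmod_power2 by (simp add: power2_eq_square algebra_simps)
  ultimately have D: "D = 2 * (x1 + x2) - 1/2" by simp
  have "D\<^sup>2 = 33/4 - 2 * sqrt 2 * sin \<theta>"
  proof -
    have eta': "\<eta> * cnj \<eta> = 1"
      using e1 by (simp add: complex_norm_square[symmetric])
    have s: "complex_of_real (sqrt 2) * complex_of_real (sqrt 2) = 2"
      by (simp flip: of_real_mult)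
    have "4 * (c1 * c2) = 4 * (c1 * c2) * (\<eta> * cnj \<eta>)" by (simp add: eta')
    also have "\<dots> = - 2 * \<i> * \<i> * (complex_of_real (sqrt 2) * complex_of_real (sqrt 2))
        * (c1 * c2) * (\<eta> * cnj \<eta>)"
      unfolding s by simp
    also have "\<dots> = - 2 * \<i> * complex_of_real (sqrt 2) * cnj \<eta>
        * (\<i> * complex_of_real (sqrt 2) * \<eta> * (c1 * c2))"
      by (simp only: mult_ac)
    finally have c12: "4 * (c1 * c2) = - 2 * \<i> * complex_of_real (sqrt 2) * cnj \<eta>"
      by (simp only: prod mult_1_right)
    have "(c1 + c2)\<^sup>2 = \<i> * \<i> / (complex_of_real (sqrt 2) * complex_of_real (sqrt 2))"
      unfolding sum by (simp add: power_divide power2_eq_square)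
    then have c1_c2: "(c1 + c2)\<^sup>2 = - 1/2" unfolding s by simp
    have "(c1 - c2)\<^sup>2 = (c1 + c2)\<^sup>2 - 4 * (c1 * c2)"
      by (simp add: power2_eq_square algebra_simps)
    also have "\<dots> = Complex (2 * sqrt 2 * sin \<theta> - 1/2) (2 * sqrt 2 * cos \<theta>)"
      unfolding c12 c1_c2 by (simp add: complex_eq_iff eta Re_exp Im_exp)
    finally have "(c1 - c2)\<^sup>2 = Complex (2 * sqrt 2 * sin \<theta> - 1/2) (2 * sqrt 2 * cos \<theta>)" .
    moreover have "D\<^sup>2 = (cmod ((c1 - c2)\<^sup>2))\<^sup>2"
      by (simp add: D_def norm_power)
    ultimately have "D\<^sup>2 = (2 * sqrt 2 * sin \<theta> - 1/2)\<^sup>2 + (2 * sqrt 2 * cos \<theta>)\<^sup>2"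
      by (simp add: cmod_power2)
    also have "\<dots> = 33/4 - 2 * sqrt 2 * sin \<theta>"
      unfolding power2_diff power_mult_distrib cos_squared_eq by (simp add: power_divide)
    finally show ?thesis .
  qed
  moreover have "1 < sqrt 2 * sin \<theta>"
    using q by (simp add: field_simps)
  ultimately have "D\<^sup>2 < (5/2)\<^sup>2" by (simp add: power2_eq_square)
  then have "D < 5/2" by (rule power2_less_imp_less) simp
  then have p: "x1 + x2 < 3/2" by (simp add: D)
  have s: "(1 - x1) * (1 - x2) = 3/2 - (x1 + x2)"
    using xx by (simp add: algebra_simps)
  have "x1 < 1 \<and> x2 < 1"
  proof (rule ccontr)
    assume "\<not> (x1 < 1 \<and> x2 < 1)"
    moreover have "0 < (1 - x1) * (1 - x2)" unfolding s using p by simp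
    ultimately have "1 \<le> x1" "1 \<le> x2" by (auto simp: zero_less_mult_iff)
    then have "1 * 1 \<le> x1 * x2" by (intro mult_mono) auto
    then show False using xx by simp
  qed
  then show "cmod c1 < 1" "cmod c2 < 1"
    by (simp_all add: x1_def x2_def power_less_one_iff abs_square_less_1)
  show "(cmod c1)\<^sup>2 * (cmod c2)\<^sup>2 = 1/2" "(cmod c1)\<^sup>2 + (cmod c2)\<^sup>2 < 3/2"
    using xx p by (simp_all add: x1_def x2_def)
  show "(cmod (1 - cnj c1 * c2))\<^sup>2 = 1 + ((cmod c1)\<^sup>2 + (cmod c2)\<^sup>2)"
    using s D unfolding cmod_one_minus_cnj_mult x1_def x2_def D_def by simp
qed

text \<open>The equation reads \<open>\<eta> * c - 1 = \<i> * sqrt 2 * \<eta> * c\<^sup>2\<close>, which gives the modulus of \<open>1 - \<eta> * c\<close>;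
  the parallelogram law then gives that of \<open>1 + \<eta> * c\<close>.\<close>

lemma cmod_one_plus_root:
  fixes \<eta> c :: complex
  assumes "cmod \<eta> = 1"
    and "- \<i> * complex_of_real (sqrt 2) * \<eta> * c\<^sup>2 + \<eta> * c - 1 = 0"
  shows "(cmod ((1 + \<eta> * c) / complex_of_real (sqrt 2)))\<^sup>2 = 1 + (cmod c)\<^sup>2 - ((cmod c)\<^sup>2)\<^sup>2"
proof -
  have "\<eta> * c - 1 = \<i> * complex_of_real (sqrt 2) * \<eta> * c\<^sup>2"
    using assms(2) by (simp add: algebra_simps)
  then have "(cmod (1 - \<eta> * c))\<^sup>2 = 2 * ((cmod c)\<^sup>2)\<^sup>2"
    unfolding norm_minus_commute[of 1]
    using assms(1) by (simp add: norm_mult norm_power power_mult_distrib)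
  moreover have "(cmod (1 + \<eta> * c))\<^sup>2 + (cmod (1 - \<eta> * c))\<^sup>2 = 2 + 2 * (cmod (\<eta> * c))\<^sup>2"
    unfolding cmod_power2 by (simp add: power2_eq_square algebra_simps)
  moreover have "cmod (\<eta> * c) = cmod c" using assms(1) by (simp add: norm_mult)
  ultimately show ?thesis
    by (simp add: norm_divide power_divide)
qed

section \<open>Positivity at the three nodes\<close>

theorem theorem9p1:
  fixes \<theta> q :: real and \<eta> :: complex and c d w :: "3 \<Rightarrow> complex"
  assumes eta: "\<eta> = exp (\<i> * complex_of_real \<theta>)"
    and q: "q = sin \<theta>" "1 / sqrt 2 < q" "q \<le> 1"
    and zero: "c 0 = 0" "d 0 = 0" "w 0 = 0"
    and roots: "{z. - \<i> * complex_of_real (sqrt 2) * \<eta> * z\<^sup>2 + \<eta> * z - 1 = 0} = {c 1, c 2}"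
    and d: "\<forall>j\<in>{1, 2}. d j = \<eta> * (c j)\<^sup>2"
    and w: "\<forall>j\<in>{1, 2}. w j = (c j + d j) / complex_of_real (sqrt 2)"
  shows
    \<comment> \<open>the second expression for \<open>d j\<close>, and non-vanishing of all denominators\<close>
    "(\<forall>j\<in>{1, 2}. 1 - \<i> * complex_of_real (sqrt 2) * c j \<noteq> 0 \<and>
                 d j = c j / (1 - \<i> * complex_of_real (sqrt 2) * c j)) \<and>
     (\<forall>j k. 1 - cnj (c j) * c k \<noteq> 0) \<and>
     (\<forall>a\<in>ball 0 1. \<forall>j. 1 - cnj a * w j \<noteq> 0) \<and>
     positive_semidefinite (R_matrix c d) \<and>
     rank (R_matrix c d) = 2 \<and>
     (\<forall>a\<in>ball 0 1. positive_definite (T_matrix (blaschke a) c w)) \<and>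
     (\<forall>a\<in>ball 0 1. \<forall>\<zeta>. norm \<zeta> = 1 \<longrightarrow>
        positive_definite (T_matrix (\<lambda>z. \<zeta> * blaschke a z) c w))"
proof -
  define s where "s = complex_of_real (sqrt 2)"
  have s2: "s * s = 2" unfolding s_def by (simp flip: of_real_mult)
  have e1: "cmod \<eta> = 1" by (simp add: eta)
  have root: "- \<i> * s * \<eta> * (c j)\<^sup>2 + \<eta> * c j - 1 = 0" if "j \<in> {1, 2}" for j
  proof -
    have "c j \<in> {c 1, c 2}" using that by auto
    then show ?thesis unfolding roots[symmetric] s_def by simp
  qed
  have q': "1 / sqrt 2 < sin \<theta>" using q by simp
  note moduli = root_moduli[OF eta q' roots]
  have "cmod (c j) < 1" for j
    using moduli(3,4) zero(1) forall_3_zero[of "\<lambda>j. cmod (c j) < 1"] by simp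
  then have den: "1 - cnj (c j) * c k \<noteq> 0" for j k
    by (simp only: one_minus_cnj_mult_nonzero less_imp_le not_False_eq_True)
  have x: "(cmod (c j))\<^sup>2 < 1" for j
    using \<open>cmod (c j) < 1\<close> by (simp add: power_less_one_iff abs_square_less_1)
  have c_nz: "c j \<noteq> 0" if "j \<in> {1, 2}" for j
    using root[OF that] by auto

  have d_alt: "1 - \<i> * s * c j \<noteq> 0 \<and> d j = c j / (1 - \<i> * s * c j)" if "j \<in> {1, 2}" for j
  proof -
    have r: "\<eta> * c j * (1 - \<i> * s * c j) = 1"
      using root[OF that] by (simp add: right_diff_distrib power2_eq_square mult_ac)
    then have nz: "1 - \<i> * s * c j \<noteq> 0" by auto
    have "d j * (1 - \<i> * s * c j) = c j * (\<eta> * c j * (1 - \<i> * s * c j))"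
      using bspec[OF d that] by (simp add: power2_eq_square)
    then have "d j * (1 - \<i> * s * c j) = c j" unfolding r by simp
    with nz show ?thesis by (simp add: eq_divide_eq)
  qed

  \<comment> \<open>The factor \<open>v j\<close> has modulus above \<open>1\<close>, but \<open>c j * v j\<close> stays in the disc.\<close>
  define v where "v j = (1 + \<eta> * c j) / s" for j
  have v: "(cmod (v j))\<^sup>2 = 1 + (cmod (c j))\<^sup>2 - ((cmod (c j))\<^sup>2)\<^sup>2" if "j \<in> {1, 2}" for j
    unfolding v_def s_def
    by (rule cmod_one_plus_root[OF e1]) (use root[OF that] in \<open>simp add: s_def\<close>)
  have wv: "w j = c j * v j" if "j \<in> {1, 2}" for j
    using bspec[OF w that] bspec[OF d that]
    unfolding v_def s_def by (simp add: power2_eq_square algebra_simps)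
  have w_lt: "cmod (w j) < 1" if "j \<in> {1, 2}" for j
  proof -
    define t where "t = (cmod (c j))\<^sup>2"
    have t: "0 \<le> t" "t < 1" using x by (auto simp: t_def)
    have "(cmod (w j))\<^sup>2 = t * (1 + t - t\<^sup>2)"
      unfolding wv[OF that] norm_mult power_mult_distrib v[OF that] by (simp add: t_def)
    also have "\<dots> = 1 - (1 - t)\<^sup>2 * (1 + t)" by (simp add: power2_eq_square algebra_simps)
    also have "\<dots> < 1" using t by simp
    finally show ?thesis by (simp add: power_less_one_iff abs_square_less_1)
  qed
  have wl: "cmod (w j) < 1" for j
    using w_lt zero(3) forall_3_zero[of "\<lambda>j. cmod (w j) < 1"] by simp
  have w_den: "1 - cnj a * w j \<noteq> 0" if "a \<in> ball 0 1" for a j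
    using one_minus_cnj_mult_nonzero[of a "w j"] that wl[of j] by simp

  have d_all: "d j = \<eta> * (c j)\<^sup>2" for j
    using d zero forall_3_zero[of "\<lambda>j. d j = \<eta> * (c j)\<^sup>2"] by simp
  note R = R_matrix_eq[OF e1 d_all den]

  have T: "positive_definite (T_matrix (\<lambda>z. \<zeta> * blaschke a z) c w)"
    if a: "a \<in> ball 0 1" and \<zeta>: "cmod \<zeta> = 1" for a \<zeta>
  proof -
    define f where "f j = v j * (\<zeta> * ((w j - a) / (1 - cnj a * w j)))" for j
    have B: "\<zeta> * blaschke a (w j) = c j * f j" if "j \<in> {1, 2}" for j
      unfolding blaschke_def f_def using wv[OF that] by simp
    have f: "(cmod (f j))\<^sup>2 \<le> 1 + (cmod (c j))\<^sup>2 - ((cmod (c j))\<^sup>2)\<^sup>2" if "j \<in> {1, 2}" for j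
    proof -
      have "cmod (f j) = cmod (v j) * cmod ((w j - a) / (1 - cnj a * w j))"
        unfolding f_def by (simp only: norm_mult \<zeta> mult_1)
      also have "\<dots> \<le> cmod (v j) * 1"
        using a wl[of j] by (intro mult_left_mono cmod_blaschke_factor_le_1) simp_all
      finally have "(cmod (f j))\<^sup>2 \<le> (cmod (v j))\<^sup>2" by (intro power_mono) simp_all
      then show ?thesis unfolding v[OF that] .
    qed
    show ?thesis
    proof (rule positive_definite_T_matrix[where f = f])
      show "(cmod (2 - cnj (f 1) * f 2))\<^sup>2 * ((1 - (cmod (c 1))\<^sup>2) * (1 - (cmod (c 2))\<^sup>2))
          < (2 - (cmod (f 1))\<^sup>2) * (2 - (cmod (f 2))\<^sup>2) * (cmod (1 - cnj (c 1) * c 2))\<^sup>2"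
        unfolding moduli(5)
        by (rule pick_determinant_estimate) (use moduli(1,2) x c_nz f in auto)
      show "(cmod (f 1))\<^sup>2 < 2"
        using f[OF insertI1] x[of 1] zero_le_power2[of "(cmod (c 1))\<^sup>2"] by linarith
      show "\<zeta> * blaschke a (w 0) = 0" by (simp add: blaschke_def zero)
    qed (use zero moduli c_nz B in auto)
  qed
  have T1: "positive_definite (T_matrix (blaschke a) c w)" if "a \<in> ball 0 1" for a
    using T[OF that, of 1] by simp
  show ?thesis
    using d_alt den w_den T T1 positive_semidefinite_one_plus_gram[of c]
      rank_one_plus_gram[of c] zero(1) c_nz[of 1]
    unfolding R s_def by simp
qed

end
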